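(* Let $q$ be a prime power and $n$ a positive integer with $\gcd(n,q)=1$. Let $F(x)=\sum_{i=0}^{n-1} f_i x^{q^i}$ with $f_i\in\mathbb{F}_q$, let $f(x)=\sum_{i=0}^{n-1} f_i x^i$ be its conventional $q$-associate, and let $E=\{e_1(x),\dots,e_t(x)\}$ be the family of the primitive idempotents of $R_{q,n}=\mathbb{F}_q[x]/\langle x^n-1\rangle$. Then $F(x)$ is a linear permutation over $\mathbb{F}_{q^n}$ if and only if $$f(x)e_i(x)\not\equiv 0 \mod x^n-1$$ for all $1\le i\le t$.
   Context: A polynomial $F(x)=\sum_{i=0}^{n-1} f_i x^{q^i}$ is a linear permutation over $\mathbb{F}_{q^n}$ if the map $\mathbb{F}_{q^n}\to\mathbb{F}_{q^n}$, $c\mapsto F(c)$, is a bijection. The conventional $q$-associate of $F(x)=\sum_{i=0}^{n-1} f_i x^{q^i}$ is $f(x)=\sum_{i=0}^{n-1} f_i x^i$. Since $\gcd(n,q)=1$, the ring $R_{q,n}=\mathbb{F}_q[x]/\langle x^n-1\rangle$ is semisimple; its primitive idempotents are the nonzero idempotents $e$ of $R_{q,n}$ that cannot be written as $e=\overline{e}+\tilde{e}$ with $\overline{e},\tilde{e}$ nonzero idempotents satisfying $\overline{e}\,\tilde{e}=0$. They are pairwise orthogonal and sum to $1$. Elements of $R_{q,n}$ are identified with polynomials of degree less than $n$. *)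

theory Defs
  imports "HOL-Library.Cardinality" "HOL-Computational_Algebra.Polynomial"
    "HOL-Number_Theory.Cong" "HOL-Number_Theory.Prime_Powers"
begin

definition field_embedding :: "('a::field \<Rightarrow> 'b::field) \<Rightarrow> bool" where
  "field_embedding h \<longleftrightarrow>
     h 1 = 1 \<and> (\<forall>x y. h (x + y) = h x + h y) \<and> (\<forall>x y. h (x * y) = h x * h y)"

definition cyc_modulus :: "nat \<Rightarrow> 'a::field poly" where
  "cyc_modulus n = monom 1 n - 1"

text \<open>
  For \<open>n > 0\<close>, the ring \<open>K[x]/(x^n - 1)\<close> over a field \<open>K\<close> is represented by the polynomials of degree less
  than \<open>n\<close>, the canonical representatives of the residue classes. On them the sum of the quotient
  ring is the sum of polynomials, whereas the product is taken modulo \<open>x^n - 1\<close>.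
\<close>

definition cyc_carrier :: "nat \<Rightarrow> 'a::field poly set" where
  "cyc_carrier n = {p. degree p < n}"

definition cyc_mult :: "nat \<Rightarrow> 'a::field poly \<Rightarrow> 'a poly \<Rightarrow> 'a poly" where
  "cyc_mult n p r = (p * r) mod cyc_modulus n"

definition nonzero_idempotents :: "nat \<Rightarrow> 'a::field poly set" where
  "nonzero_idempotents n = {e \<in> cyc_carrier n. e \<noteq> 0 \<and> cyc_mult n e e = e}"

definition primitive_idempotents :: "nat \<Rightarrow> 'a::field poly set" where
  "primitive_idempotents n =
     {e \<in> nonzero_idempotents n.
        \<not> (\<exists>e1 \<in> nonzero_idempotents n. \<exists>e2 \<in> nonzero_idempotents n.
              e = e1 + e2 \<and> cyc_mult n e1 e2 = 0)}"

definition q_polynomial :: "nat \<Rightarrow> nat \<Rightarrow> (nat \<Rightarrow> 'a::field) \<Rightarrow> 'a poly" where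
  "q_polynomial q n f = (\<Sum>i<n. monom (f i) (q ^ i))"

definition q_associate :: "nat \<Rightarrow> (nat \<Rightarrow> 'a::field) \<Rightarrow> 'a poly" where
  "q_associate n f = (\<Sum>i<n. monom (f i) i)"

text \<open>
  The extension field is a separate type \<open>'b\<close>, with the base field embedded in it by \<open>h\<close>;
  \<open>F\<close> is evaluated on \<open>'b\<close> after its coefficients have been mapped along \<open>h\<close>.
\<close>

definition permutation_over :: "('a::field \<Rightarrow> 'b::field) \<Rightarrow> 'a poly \<Rightarrow> bool" where
  "permutation_over h F \<longleftrightarrow> bij (\<lambda>c. poly (map_poly h F) c)"

end

theory Submission
  imports Defs
begin

text \<open>
  The polynomial ring \<open>K[x]\<close> over \<open>K = GF(q)\<close> acts on \<open>GF(q^n)\<close> by letting \<open>x\<close> act as the Frobenius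
  map \<open>c \<mapsto> c^q\<close>; since Frobenius is additive and fixes \<open>K\<close>, multiplication of polynomials becomes
  composition of maps (\<open>frob_map_mult\<close>). The map of the \<open>q\<close>-polynomial \<open>F\<close> is the action of its
  associate \<open>f\<close>. As \<open>c^(q^n) = c\<close>, the modulus \<open>x^n - 1\<close> acts as zero, and by counting roots no
  nonzero polynomial of degree below \<open>n\<close> does (\<open>frob_map_faithful\<close>): the ring \<open>K[x]/(x^n - 1)\<close> acts
  faithfully.

  If \<open>F\<close> permutes the field and \<open>f e\<close> vanishes modulo \<open>x^n - 1\<close>, then \<open>e\<close> acts as zero, so \<open>e = 0\<close>
  by faithfulness; hence no nonzero idempotent is annihilated by \<open>f\<close>.

  Conversely, \<open>n\<close> is invertible in \<open>K\<close>, so \<open>x^n - 1\<close> is squarefree. If \<open>f\<close> shared an irreducible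
  factor \<open>p\<close> with \<open>x^n - 1 = p g\<close>, then \<open>p\<close> and \<open>g\<close> would be coprime, and the idempotent that is
  \<open>1\<close> modulo \<open>p\<close> and \<open>0\<close> modulo \<open>g\<close> would be primitive (because \<open>p\<close> is irreducible) and annihilated
  by \<open>f\<close> (\<open>primitive_idempotent_of_factor\<close>). So \<open>f\<close> is coprime to \<open>x^n - 1\<close>, and a Bezout
  identity \<open>u f + v (x^n - 1) = 1\<close> exhibits the action of \<open>u\<close> as an inverse of the map of \<open>F\<close>.
\<close>

section \<open>Bezout identities and irreducible factors\<close>

lemma bezout_common_divisor:
  fixes a b :: "'a::euclidean_ring"
  shows "\<exists>d u v. d dvd a \<and> d dvd b \<and> u * a + v * b = d"
proof (induction "euclidean_size b" arbitrary: a b rule: less_induct)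
  case less
  show ?case
  proof (cases "b = 0")
    case True
    then show ?thesis
      by (intro exI[of _ a] exI[of _ 1] exI[of _ 0]) simp
  next
    case False
    then have "euclidean_size (a mod b) < euclidean_size b"
      by (rule mod_size_less)
    from less[OF this, of b] obtain d u v
      where d: "d dvd b" "d dvd a mod b" "u * b + v * (a mod b) = d"
      by blast
    have "d dvd a"
      using d(1,2) by (simp add: dvd_mod_iff)
    moreover have "v * a + (u - v * (a div b)) * b = d"
      using d(3) by (simp add: minus_div_mult_eq_mod[symmetric] algebra_simps)
    ultimately show ?thesis
      using d(1) by blast
  qed
qed

lemma irreducible_bezout:
  fixes p a :: "'a::euclidean_ring"
  assumes "irreducible p" "\<not> p dvd a"
  shows "\<exists>u v. u * p + v * a = 1"
proof -
  obtain d u v where d: "d dvd p" "d dvd a" "u * p + v * a = d"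
    using bezout_common_divisor[of p a] by blast
  then obtain c where c: "p = d * c"
    by blast
  have "\<not> c dvd 1"
  proof
    assume "c dvd 1"
    then have "p dvd d"
      by (simp add: c mult_unit_dvd_iff)
    with d(2) assms(2) show False
      using dvd_trans by blast
  qed
  with irreducibleD[OF assms(1) c] have "d dvd 1"
    by blast
  then obtain w where "1 = d * w" ..
  also have "d * w = (w * u) * p + (w * v) * a"
    by (simp add: d(3)[symmetric] algebra_simps)
  finally have "(w * u) * p + (w * v) * a = 1" ..
  then show ?thesis
    by blast
qed

lemma irreducible_factor_exists:
  fixes d :: "'a::field poly"
  assumes "d \<noteq> 0" "\<not> d dvd 1"
  shows "\<exists>p. irreducible p \<and> p dvd d"
  using assms
proof (induction "degree d" arbitrary: d rule: less_induct)
  case less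
  show ?case
  proof (cases "irreducible d")
    case False
    then obtain a b where ab: "d = a * b" "\<not> a dvd 1" "\<not> b dvd 1"
      using less.prems by (auto simp: irreducible_def)
    with less.prems have nz: "a \<noteq> 0" "b \<noteq> 0"
      by auto
    have "degree b > 0"
      using ab(3) nz(2) by (simp add: is_unit_iff_degree)
    then have "degree a < degree d"
      using nz by (simp add: ab(1) degree_mult_eq)
    with less.hyps nz ab show ?thesis
      by (meson dvd_mult2)
  qed auto
qed

section \<open>Primitive idempotents from irreducible factors\<close>

lemma degree_cyc_modulus:
  assumes "n > 0"
  shows "degree (cyc_modulus n :: 'a::field poly) = n"
proof -
  have "degree (- 1 + monom 1 n :: 'a poly) = degree (monom 1 n :: 'a poly)"
    by (rule degree_add_eq_right) (use assms in \<open>simp add: degree_monom_eq\<close>)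
  then show ?thesis
    by (simp add: cyc_modulus_def degree_monom_eq)
qed

lemma mod_cyc_modulus_in_carrier:
  assumes "n > 0"
  shows "p mod cyc_modulus n \<in> cyc_carrier n"
proof -
  have "(cyc_modulus n :: 'a poly) \<noteq> 0"
    using degree_cyc_modulus[OF assms, where 'a = 'a] assms by auto
  then show ?thesis
    using degree_mod_less'[of "cyc_modulus n" p] degree_cyc_modulus[OF assms, where 'a = 'a] assms
    by (cases "p mod cyc_modulus n = 0") (auto simp: cyc_carrier_def)
qed

lemma carrier_modulus_dvd_imp_zero:
  assumes "n > 0" "p \<in> cyc_carrier n" "cyc_modulus n dvd p"
  shows "p = 0"
proof (rule ccontr)
  assume "p \<noteq> 0"
  with assms(3) have "degree (cyc_modulus n :: 'a poly) \<le> degree p"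
    by (rule dvd_imp_degree_le)
  with assms show False
    by (simp add: degree_cyc_modulus cyc_carrier_def)
qed

lemma nonzero_idempotentD:
  assumes "e \<in> nonzero_idempotents n"
  shows "e \<in> cyc_carrier n" "e \<noteq> 0" "cyc_modulus n dvd e * e - e"
proof -
  show "e \<in> cyc_carrier n" "e \<noteq> 0"
    using assms by (auto simp: nonzero_idempotents_def)
  have "(e * e) mod cyc_modulus n = e"
    using assms by (auto simp: nonzero_idempotents_def cyc_mult_def)
  then show "cyc_modulus n dvd e * e - e"
    by (metis dvd_minus_mod)
qed

text \<open>
  A repeated factor would divide both \<open>x^n - 1\<close> and \<open>n x^(n-1)\<close>,
  hence the unit \<open>x (n x^(n-1)) - n (x^n - 1) = n\<close>.
\<close>

lemma cyc_modulus_squarefree: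
  fixes p :: "'a::field poly"
  assumes n: "n > 0" "of_nat n \<noteq> (0::'a)" and sq: "p * p dvd cyc_modulus n"
  shows "p dvd 1"
proof -
  obtain k where k: "cyc_modulus n = p * p * k"
    using sq by blast
  have "p dvd pderiv (cyc_modulus n)"
    unfolding k by (simp add: pderiv_mult dvd_add)
  moreover have "p dvd cyc_modulus n"
    unfolding k by (simp add: mult.assoc)
  ultimately have "p dvd monom 1 1 * pderiv (cyc_modulus n) - smult (of_nat n) (cyc_modulus n)"
    by (intro dvd_diff dvd_mult dvd_smult)
  also have "monom 1 1 * pderiv (cyc_modulus n) - smult (of_nat n) (cyc_modulus n) = [:of_nat n :: 'a:]"
    using n(1) by (simp add: cyc_modulus_def pderiv_diff pderiv_monom mult_monom smult_diff_right
        smult_monom right_diff_distrib monom_0)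
  finally show ?thesis
    using n(2) by (meson dvd_trans is_unit_triv)
qed

text \<open>
  With \<open>u p + v g = 1\<close>, the class of \<open>v g\<close> is \<open>1\<close> modulo \<open>p\<close> and \<open>0\<close> modulo \<open>g\<close>. It is primitive
  because the parts of an orthogonal splitting are multiples of it, hence of \<open>g\<close>, and the irreducible
  \<open>p\<close> divides one of them; that part is then zero.
\<close>

lemma primitive_idempotent_of_factor:
  fixes p g :: "'a::field poly"
  assumes n: "n > 0" "of_nat n \<noteq> (0::'a)"
    and irr: "irreducible p" and m: "cyc_modulus n = p * g"
  shows "\<exists>e \<in> primitive_idempotents n. g dvd e"
proof -
  let ?m = "cyc_modulus n :: 'a poly"
  have "\<not> p dvd g"
  proof
    assume "p dvd g"
    then have "p * p dvd ?m"
      unfolding m by simp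
    with cyc_modulus_squarefree[OF n] irreducible_not_unit[OF irr] show False
      by blast
  qed
  then obtain u v where uv: "u * p + v * g = 1"
    using irreducible_bezout[OF irr] by blast
  define e where "e = (v * g) mod ?m"
  have e_cong: "?m dvd v * g - e"
    unfolding e_def by (rule dvd_minus_mod)
  have g_m: "g dvd ?m" and p_m: "p dvd ?m"
    unfolding m by auto
  have g_e: "g dvd e"
    unfolding e_def using g_m by (simp add: dvd_mod)
  have e_nz: "e \<noteq> 0"
  proof
    assume "e = 0"
    with e_cong p_m have "p dvd v * g"
      using dvd_trans by auto
    then have "p dvd u * p + v * g"
      by (intro dvd_add) simp_all
    then have "p dvd 1"
      by (simp only: uv)
    with irreducible_not_unit[OF irr] show False ..
  qed
  have "v * g * (v * g) - v * g = - (u * v) * ?m"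
  proof -
    have "v * g * (v * g) - v * g = - (v * g * (1 - v * g))"
      by (simp add: algebra_simps)
    also have "1 - v * g = u * p"
      by (simp add: uv[symmetric])
    finally show ?thesis
      by (simp add: m mult_ac)
  qed
  then have "(v * g * (v * g)) mod ?m = (v * g) mod ?m"
    by (simp add: mod_eq_dvd_iff)
  then have "cyc_mult n e e = e"
    by (simp add: cyc_mult_def e_def mod_mult_eq)
  then have e_idem: "e \<in> nonzero_idempotents n"
    using e_nz mod_cyc_modulus_in_carrier[OF n(1)]
    by (simp add: nonzero_idempotents_def e_def)
  have "\<not> (\<exists>e1 \<in> nonzero_idempotents n. \<exists>e2 \<in> nonzero_idempotents n.
          e = e1 + e2 \<and> cyc_mult n e1 e2 = 0)"
  proof
    assume "\<exists>e1 \<in> nonzero_idempotents n. \<exists>e2 \<in> nonzero_idempotents n.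
          e = e1 + e2 \<and> cyc_mult n e1 e2 = 0"
    then obtain e1 e2 where e12: "e1 \<in> nonzero_idempotents n" "e2 \<in> nonzero_idempotents n"
        and sum: "e = e1 + e2" and "cyc_mult n e1 e2 = 0"
      by blast
    then have prod: "?m dvd e1 * e2"
      by (simp add: cyc_mult_def dvd_eq_mod_eq_0)
    \<comment> \<open>A part \<open>a\<close> satisfies \<open>a = a (a + b) = a e\<close> modulo \<open>x^n - 1\<close>.\<close>
    have g_part: "g dvd a"
      if "a \<in> nonzero_idempotents n" "e = a + b" "?m dvd a * b" for a b
    proof -
      have "?m dvd (a * a - a) + a * b"
        using nonzero_idempotentD(3)[OF that(1)] that(3) by (rule dvd_add)
      also have "(a * a - a) + a * b = a * e - a"
        using that(2) by (simp add: algebra_simps)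
      finally have "g dvd a * e - a"
        using g_m dvd_trans by blast
      moreover have "g dvd a * e"
        using g_e by (rule dvd_mult)
      ultimately have "g dvd a * e - (a * e - a)"
        by (metis dvd_diff)
      then show ?thesis
        by simp
    qed
    have g12: "g dvd e1" "g dvd e2"
      using g_part[OF e12(1) sum prod]
        g_part[OF e12(2) sum[unfolded add.commute[of e1]] prod[unfolded mult.commute[of e1]]] .
    \<comment> \<open>The coprime \<open>p\<close> and \<open>g\<close> together would make \<open>x^n - 1\<close> divide the reduced \<open>a\<close>, forcing \<open>a = 0\<close>.\<close>
    have no_p: "\<not> p dvd a" if a: "a \<in> nonzero_idempotents n" "g dvd a" for a
    proof
      assume "p dvd a"
      then have "?m dvd p * a" "?m dvd g * a"
        using a(2) by (simp_all add: m mult.commute[of p g] mult_dvd_mono)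
      then have "?m dvd u * (p * a) + v * (g * a)"
        by (intro dvd_add dvd_mult[of _ "p * a"] dvd_mult[of _ "g * a"])
      also have "u * (p * a) + v * (g * a) = (u * p + v * g) * a"
        by (simp add: algebra_simps)
      finally have "?m dvd a"
        by (simp add: uv)
      then show False
        using carrier_modulus_dvd_imp_zero[OF n(1)] nonzero_idempotentD[OF a(1)] by blast
    qed
    \<comment> \<open>\<open>p\<close> divides \<open>e1 e2\<close> but not \<open>e1\<close>, so it must divide \<open>e2\<close>.\<close>
    obtain r s where rs: "r * p + s * e1 = 1"
      using irreducible_bezout[OF irr no_p[OF e12(1) g12(1)]] by blast
    have "p dvd e1 * e2"
      using p_m prod dvd_trans by blast
    then have "p dvd p * (r * e2) + s * (e1 * e2)"
      by simp
    also have "p * (r * e2) + s * (e1 * e2) = (r * p + s * e1) * e2"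
      by (simp add: algebra_simps)
    finally have "p dvd e2"
      by (simp add: rs)
    with no_p[OF e12(2) g12(2)] show False ..
  qed
  with e_idem g_e show ?thesis
    by (auto simp: primitive_idempotents_def)
qed

lemma bezout_of_primitive_idempotents_not_annihilated:
  fixes f :: "'a::field poly"
  assumes n: "n > 0" "of_nat n \<noteq> (0::'a)"
    and nz: "\<forall>e \<in> primitive_idempotents n. \<not> cyc_modulus n dvd f * e"
  shows "\<exists>u v. u * f + v * cyc_modulus n = 1"
proof -
  let ?m = "cyc_modulus n :: 'a poly"
  have m_nz: "?m \<noteq> 0"
    using degree_cyc_modulus[OF n(1), where 'a = 'a] n(1) by auto
  obtain d u v where d: "d dvd f" "d dvd ?m" "u * f + v * ?m = d"
    using bezout_common_divisor[of f ?m] by blast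
  have "d dvd 1"
  proof (rule ccontr)
    assume "\<not> d dvd 1"
    moreover have "d \<noteq> 0"
      using d(2) m_nz by auto
    ultimately obtain p where p: "irreducible p" "p dvd d"
      using irreducible_factor_exists by blast
    then obtain g where g: "?m = p * g"
      using d(2) dvd_trans by blast
    obtain e where e: "e \<in> primitive_idempotents n" "g dvd e"
      using primitive_idempotent_of_factor[OF n p(1) g] by blast
    have "p dvd f"
      using p(2) d(1) by (rule dvd_trans)
    then have "?m dvd f * e"
      unfolding g using e(2) by (rule mult_dvd_mono)
    with nz e(1) show False
      by blast
  qed
  then obtain w where "1 = d * w" ..
  also have "d * w = (w * u) * f + (w * v) * ?m"
    by (simp add: d(3)[symmetric] algebra_simps)
  finally have "(w * u) * f + (w * v) * ?m = 1" ..
  then show ?thesis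
    by blast
qed

section \<open>Polynomials acting through the Frobenius map\<close>

locale frobenius_action =
  fixes h :: "'a::field \<Rightarrow> 'b::field" and q :: nat
  assumes embedding: "field_embedding h"
    and frob_add: "(x + y :: 'b) ^ q = x ^ q + y ^ q"
    and frob_fixes_base: "h a ^ q = h a"
begin

lemma h_one: "h 1 = 1" and h_add: "h (x + y) = h x + h y" and h_mult: "h (x * y) = h x * h y"
  using embedding by (auto simp: field_embedding_def)

lemma h_zero: "h 0 = 0"
  by (metis h_add add_cancel_right_right)

lemma h_uminus: "h (- x) = - h x"
  by (metis h_add h_zero add.right_inverse minus_unique)

lemma h_sum: "h (sum g A) = (\<Sum>i\<in>A. h (g i))"
  by (induction A rule: infinite_finite_induct) (auto simp: h_zero h_add)

lemma h_eq_zero_iff: "h x = 0 \<longleftrightarrow> x = 0"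
proof
  assume "h x = 0"
  then have "h (x * inverse x) = 0"
    by (simp add: h_mult)
  then show "x = 0"
    by (metis h_one right_inverse zero_neq_one)
qed (simp add: h_zero)

lemma frob_zero: "(0::'b) ^ q = 0"
  by (metis frob_add add_cancel_right_right)

lemma frob_sum: "(sum g A :: 'b) ^ q = (\<Sum>i\<in>A. g i ^ q)"
  by (induction A rule: infinite_finite_induct) (auto simp: frob_zero frob_add)

text \<open>
  The same coefficients as in the \<open>q\<close>-polynomial of \<open>p\<close>, but taken from the associate \<open>p\<close> itself,
  so that the product of associates can be compared with the composition of the maps.
\<close>

definition frob_map :: "'a poly \<Rightarrow> 'b \<Rightarrow> 'b" where
  "frob_map p c = (\<Sum>i\<le>degree p. h (coeff p i) * c ^ (q ^ i))"

lemma frob_map_bound: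
  assumes "degree p < N"
  shows "frob_map p c = (\<Sum>i<N. h (coeff p i) * c ^ (q ^ i))"
  unfolding frob_map_def using assms
  by (intro sum.mono_neutral_left) (auto simp: h_zero coeff_eq_0)

lemma frob_map_0: "frob_map 0 c = 0"
  by (simp add: frob_map_def h_zero)

lemma frob_map_1: "frob_map 1 c = c"
  by (simp add: frob_map_def h_one)

lemma frob_map_add: "frob_map (p + r) c = frob_map p c + frob_map r c"
proof -
  define N where "N = Suc (max (degree p) (degree r))"
  have "degree p < N" "degree r < N" "degree (p + r) < N"
    using degree_add_le_max[of p r] by (auto simp: N_def)
  then show ?thesis
    by (simp add: frob_map_bound h_add distrib_right sum.distrib)
qed

lemma frob_map_smult: "frob_map (smult a p) c = h a * frob_map p c"
proof -
  have "degree (smult a p) < Suc (degree p)"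
    using degree_smult_le[of a p] by simp
  then have "frob_map (smult a p) c = (\<Sum>i<Suc (degree p). h (coeff (smult a p) i) * c ^ (q ^ i))"
    by (rule frob_map_bound)
  also have "\<dots> = h a * (\<Sum>i<Suc (degree p). h (coeff p i) * c ^ (q ^ i))"
    by (simp only: coeff_smult h_mult sum_distrib_left mult.assoc)
  finally show ?thesis
    by (simp only: frob_map_bound[of p "Suc (degree p)"] lessI)
qed

lemma frob_map_shift: "frob_map (pCons 0 p) c = frob_map p (c ^ q)"
proof -
  have "degree (pCons 0 p) < Suc (Suc (degree p))"
    by (simp add: degree_pCons_le less_Suc_eq_le)
  then have "frob_map (pCons 0 p) c
      = (\<Sum>i<Suc (Suc (degree p)). h (coeff (pCons 0 p) i) * c ^ (q ^ i))"
    by (rule frob_map_bound)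
  also have "\<dots> = (\<Sum>i<Suc (degree p). h (coeff p i) * (c ^ q) ^ (q ^ i))"
    by (subst sum.lessThan_Suc_shift) (simp add: h_zero power_mult[symmetric] del: sum.lessThan_Suc)
  finally show ?thesis
    by (simp only: frob_map_bound[of p "Suc (degree p)"] lessI)
qed

text \<open>
  The action commutes with Frobenius because its coefficients lie in the base field; this is what
  turns products into compositions.
\<close>

lemma frob_map_frob: "frob_map p (c ^ q) = frob_map p c ^ q"
  by (simp add: frob_map_def frob_sum power_mult_distrib frob_fixes_base
      power_mult[symmetric] mult.commute[of q])

lemma frob_map_mult: "frob_map (r * p) c = frob_map r (frob_map p c)"
proof (induction r arbitrary: c)
  case 0
  then show ?case
    by (simp add: frob_map_0)
next
  case (pCons a r)
  have "frob_map (pCons a r * p) c = h a * frob_map p c + frob_map (r * p) (c ^ q)"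
    by (simp add: frob_map_add frob_map_smult frob_map_shift)
  also have "\<dots> = h a * frob_map p c + frob_map r (frob_map p c ^ q)"
    by (simp add: pCons.IH frob_map_frob)
  also have "\<dots> = frob_map (smult a 1 + pCons 0 r) (frob_map p c)"
    by (simp only: frob_map_add frob_map_smult frob_map_shift frob_map_1)
  also have "smult a 1 + pCons 0 r = pCons a r"
    by simp
  finally show ?case .
qed

lemma frob_map_at_0: "frob_map p 0 = 0"
  using frob_map_mult[of p 0 0] by (simp add: frob_map_0)

lemma frob_map_cyc_modulus:
  assumes "c ^ (q ^ n) = c"
  shows "frob_map (cyc_modulus n) c = 0"
proof -
  have "frob_map (monom 1 n) c = c"
    using assms by (simp add: frob_map_def degree_monom_eq if_distrib[of h] h_zero h_one
        if_distrib[of "\<lambda>x. x * _"] cong: if_cong)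
  moreover have "frob_map (smult (- 1) 1) c = - c"
    by (simp only: frob_map_smult frob_map_1 h_uminus h_one) simp
  ultimately have "frob_map (monom 1 n + smult (- 1) 1) c = 0"
    by (simp only: frob_map_add) simp
  also have "monom 1 n + smult (- 1) 1 = (cyc_modulus n :: 'a poly)"
    by (simp only: cyc_modulus_def smult_minus_left smult_1_left add_uminus_conv_diff)
  finally show ?thesis .
qed

lemma frob_map_eq_0_of_modulus_dvd:
  assumes "\<And>x::'b. x ^ (q ^ n) = x" "cyc_modulus n dvd p"
  shows "frob_map p c = 0"
  using assms by (auto elim!: dvdE simp: frob_map_mult frob_map_cyc_modulus)

lemma poly_q_polynomial:
  "poly (map_poly h (q_polynomial q n a)) c = (\<Sum>i<n. h (a i) * c ^ (q ^ i))"
proof -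
  have "map_poly h (q_polynomial q n a) = (\<Sum>i<n. monom (h (a i)) (q ^ i))"
    by (intro poly_eqI)
      (auto simp: q_polynomial_def coeff_map_poly h_zero coeff_sum h_sum intro!: sum.cong)
  then show ?thesis
    by (simp add: poly_sum poly_monom)
qed

lemma coeff_q_associate: "coeff (q_associate n a) i = (if i < n then a i else 0)"
  by (simp add: q_associate_def coeff_sum)

lemma poly_q_polynomial_eq_frob_map:
  assumes "n > 0"
  shows "poly (map_poly h (q_polynomial q n a)) c = frob_map (q_associate n a) c"
proof -
  have "degree (q_associate n a) < n"
    using assms by (intro degree_lessI) (auto simp: coeff_q_associate)
  then show ?thesis
    by (simp add: poly_q_polynomial frob_map_bound coeff_q_associate)
qed

text \<open>
  A polynomial \<open>p\<close> of degree below \<open>n\<close> acts as an ordinary polynomial of degree at most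
  \<open>q^(n-1)\<close>, which cannot vanish at all of the \<open>q^n\<close> field elements.
\<close>

lemma frob_map_faithful:
  assumes q: "q > 1" and card: "CARD('b) = q ^ n"
    and deg: "degree p < n" and zero: "\<And>c. frob_map p c = 0"
  shows "p = 0"
proof -
  define G where "G = map_poly h (q_polynomial q n (coeff p))"
  have q_assoc: "q_associate n (coeff p) = p"
    using deg by (intro poly_eqI) (auto simp: coeff_q_associate coeff_eq_0)
  have roots: "poly G c = 0" for c
    using zero deg by (simp add: G_def poly_q_polynomial_eq_frob_map q_assoc)
  have coeff_G: "coeff G k = (\<Sum>i<n. if q ^ i = k then h (coeff p i) else 0)" for k
    by (auto simp: G_def q_polynomial_def coeff_map_poly h_zero coeff_sum h_sum intro!: sum.cong)
  have "degree G < q ^ n"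
  proof (rule degree_lessI)
    show "G \<noteq> 0 \<or> q ^ n > 0"
      using q by simp
    show "\<forall>k\<ge>q ^ n. coeff G k = 0"
    proof (intro allI impI)
      fix k assume "q ^ n \<le> k"
      then have "q ^ i \<noteq> k" if "i < n" for i
        using power_strict_increasing[OF that q] by simp
      then show "coeff G k = 0"
        by (simp add: coeff_G)
    qed
  qed
  then have "G = 0"
    using card_poly_roots_bound[of G] roots card by force
  have "coeff p j = 0" for j
  proof (cases "j < n")
    case True
    then have "coeff G (q ^ j) = h (coeff p j)"
      using q by (simp add: coeff_G power_inject_exp)
    then show ?thesis
      using \<open>G = 0\<close> by (simp add: h_eq_zero_iff)
  qed (use deg in \<open>simp add: coeff_eq_0\<close>)
  then show ?thesis
    by (simp add: poly_eq_iff)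
qed

end

section \<open>Frobenius on finite fields\<close>

lemma power_CARD_eq_self:
  fixes x :: "'a::{field,finite}"
  shows "x ^ CARD('a) = x"
proof (cases "x = 0")
  case False
  let ?U = "UNIV - {0} :: 'a set"
  \<comment> \<open>Multiplication by \<open>x\<close> permutes the nonzero elements, so it preserves their product.\<close>
  have "bij_betw ((*) x) ?U ?U"
    using False by (intro bij_betw_byWitness[where f' = "\<lambda>y. y / x"]) auto
  then have "(\<Prod>y\<in>?U. x * y) = \<Prod>?U"
    by (rule prod.reindex_bij_betw)
  then have "x ^ card ?U = 1"
    by (simp add: prod.distrib)
  moreover have "CARD('a) = Suc (card ?U)"
    by (simp add: card_Suc_Diff1)
  ultimately show ?thesis
    by (simp only: power_Suc mult_1_right)
qed (simp add: zero_power)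

lemma CHAR_dvd_CARD: "CHAR('a::{ring_1,finite}) dvd CARD('a)"
proof -
  \<comment> \<open>Translation by \<open>1\<close> permutes the ring, so it preserves the sum of all elements.\<close>
  have "bij_betw (\<lambda>x. x + 1) (UNIV :: 'a set) UNIV"
    by (intro bij_betw_byWitness[where f' = "\<lambda>x. x - 1"]) auto
  then have "(\<Sum>x\<in>UNIV. x + 1) = (\<Sum>x\<in>UNIV. x :: 'a)"
    by (rule sum.reindex_bij_betw)
  then have "of_nat CARD('a) = (0::'a)"
    by (simp add: sum.distrib)
  then show ?thesis
    by (simp only: of_nat_eq_0_iff_char_dvd)
qed

lemma CHAR_eq_of_CARD_prime_power:
  assumes "prime p" "CARD('a::{field,finite}) = p ^ k"
  shows "CHAR('a) = p"
proof -
  have "CHAR('a) > 0"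
    by (rule finite_imp_CHAR_pos) simp
  then have "prime CHAR('a)"
    by (rule prime_CHAR_semidom)
  moreover have "CHAR('a) dvd p ^ k"
    using CHAR_dvd_CARD[where 'a = 'a] assms(2) by simp
  ultimately show ?thesis
    using assms(1) prime_dvd_power primes_dvd_imp_eq by blast
qed

section \<open>Linear permutations and primitive idempotents\<close>

theorem theorem13:
  fixes q n :: nat
    and h :: "'a::{field,finite} \<Rightarrow> 'b::{field,finite}"
    and f :: "nat \<Rightarrow> 'a"
  assumes "primepow q"
    and "n > 0"
    and "coprime n q"
    and "CARD('a) = q"
    and "CARD('b) = q ^ n"
    and "field_embedding h"
  shows "permutation_over h (q_polynomial q n f) \<longleftrightarrow>
    (\<forall>e \<in> primitive_idempotents n. [q_associate n f * e \<noteq> 0] (mod cyc_modulus n))"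
proof -
  obtain p k where p: "prime p" "k > 0" "q = p ^ k"
    using assms(1) by (auto simp: primepow_def)
  have q: "q > 1"
    using assms(1) by (rule primepow_gt_Suc_0[unfolded One_nat_def[symmetric]])
  have char_a: "CHAR('a) = p"
    using CHAR_eq_of_CARD_prime_power[OF p(1)] assms(4) p(3) by blast
  have char_b: "CHAR('b) = p"
    using CHAR_eq_of_CARD_prime_power[OF p(1), of "k * n"] assms(5) p(3) by (simp add: power_mult)
  have n_nz: "of_nat n \<noteq> (0::'a)"
  proof
    assume "of_nat n = (0::'a)"
    then have "p dvd n"
      by (simp add: of_nat_eq_0_iff_char_dvd char_a)
    moreover have "p dvd q"
      using p by simp
    ultimately show False
      using assms(3) p(1) by (meson coprime_common_divisor not_prime_unit)
  qed
  have h_power: "h (x ^ j) = h x ^ j" for x j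
    using assms(6) by (induction j) (auto simp: field_embedding_def)
  interpret frobenius_action h q
  proof
    show "(x + y) ^ q = x ^ q + y ^ q" for x y :: 'b
      using p char_b by (intro freshmans_dream') auto
    show "h a ^ q = h a" for a
      using h_power[of a q] power_CARD_eq_self[of a] assms(4) by simp
  qed (rule assms(6))
  have frob_n: "x ^ (q ^ n) = x" for x :: 'b
    using power_CARD_eq_self[of x] assms(5) by simp
  let ?m = "cyc_modulus n :: 'a poly" and ?f = "q_associate n f"
  have perm: "permutation_over h (q_polynomial q n f) \<longleftrightarrow> bij (frob_map ?f)"
    using assms(2) by (simp add: permutation_over_def poly_q_polynomial_eq_frob_map)
  have "bij (frob_map ?f) \<longleftrightarrow> (\<forall>e \<in> primitive_idempotents n. \<not> ?m dvd ?f * e)"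
  proof
    assume bij: "bij (frob_map ?f)"
    show "\<forall>e \<in> primitive_idempotents n. \<not> ?m dvd ?f * e"
    proof (intro ballI notI)
      fix e assume "e \<in> primitive_idempotents n" and dvd: "?m dvd ?f * e"
      then have e: "degree e < n" "e \<noteq> 0"
        by (auto simp: primitive_idempotents_def nonzero_idempotents_def cyc_carrier_def)
      have "frob_map ?f (frob_map e c) = frob_map ?f 0" for c
        using frob_map_eq_0_of_modulus_dvd[OF frob_n dvd]
        by (simp add: frob_map_mult frob_map_at_0)
      then have "frob_map e c = 0" for c
        using bij by (meson bij_is_inj injD)
      with e frob_map_faithful[OF q assms(5)] show False
        by blast
    qed
  next
    assume "\<forall>e \<in> primitive_idempotents n. \<not> ?m dvd ?f * e"
    then obtain u v where uv: "u * ?f + v * ?m = 1"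
      using bezout_of_primitive_idempotents_not_annihilated[OF assms(2) n_nz] by blast
    have "frob_map u (frob_map ?f c) = c" for c
    proof -
      have "frob_map (u * ?f + v * ?m) c = frob_map u (frob_map ?f c)"
        by (simp add: frob_map_add frob_map_mult frob_map_cyc_modulus[OF frob_n] frob_map_at_0)
      then show ?thesis
        by (simp add: uv frob_map_1)
    qed
    then have "inj (frob_map ?f)"
      by (rule inj_on_inverseI)
    then show "bij (frob_map ?f)"
      by (simp add: bij_def finite_UNIV_inj_surj)
  qed
  then show ?thesis
    by (simp add: perm cong_0_iff)
qed

end
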